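(* Let $T>0$, $R\ge 0$, and let $\xi\in C([0,T])$ be a real-valued continuous path. Let $\Theta:\mathbb{R}^2\to\mathbb{R}$ be uniformly continuous with $\Theta\ge 0$ everywhere and $\Theta(x,y)\ge 1$ whenever $\min\{x,y\}\ge R$. Let $u:[0,T]\times\mathbb{R}^2\to\mathbb{R}$ be the (Lions–Souganidis) viscosity solution of $$\partial_t u = \big(|\partial_x u| - |\partial_y u|\big)\,\dot\xi(t)\quad\text{on } (0,T)\times\mathbb{R}^2,\qquad u(0,x,y)=|x-y|+\Theta(x,y).$$ Then $$u(T,0,0)\;\ge\;\min\left\{\left(\sup_{(t_0,\dots,t_n)\in\mathcal{P}}\ \frac{\sum_{j=0}^{n-1}|\xi(t_{j+1})-\xi(t_j)|}{n}-\frac{R}{n}\right)_+,\ 1\right\}.$$ In particular, $u(T,0,0)>0$ whenever $V_{0,T}(\xi)>R$.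
   Context: $\mathcal{P}$ denotes the set of partitions $(t_0,\dots,t_n)$ of $[0,T]$ with $0=t_0\le t_1\le\dots\le t_n=T$ ($n\ge1$ arbitrary). The total variation is $V_{0,T}(\xi)=\sup_{(t_0,\dots,t_n)\in\mathcal{P}}\sum_{i=0}^{n-1}|\xi(t_{i+1})-\xi(t_i)|$. $(a)_+=\max\{a,0\}$. For $\xi\in C^1$, the equation is understood in the classical viscosity sense with $\dot\xi$ the derivative; for merely continuous $\xi$, the solution is defined (following Lions–Souganidis, valid since $H(p,q)=|p|-|q|$ is a difference of convex Lipschitz functions) as the unique function $u$ such that, for every sequence $\xi_k\in C^1([0,T])$ with $\xi_k\to\xi$ uniformly, the viscosity solutions $u_k$ of the equation driven by $\xi_k$ with the same initial datum converge locally uniformly to $u$. *)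

theory Defs
  imports "HOL-Analysis.Analysis"
begin

type_synonym point3 = "real \<times> real \<times> real"  (* (t, x, y) *)

definition C1_path :: "real \<Rightarrow> (real \<Rightarrow> real) \<Rightarrow> (real \<Rightarrow> real) \<Rightarrow> bool" where
  "C1_path T xi xi' \<longleftrightarrow>
     (\<forall>t\<in>{0..T}. (xi has_real_derivative xi' t) (at t within {0..T})) \<and>
     continuous_on {0..T} xi'"

definition C1_test :: "(point3 \<Rightarrow> real) \<Rightarrow> (point3 \<Rightarrow> real) \<Rightarrow> (point3 \<Rightarrow> real)
    \<Rightarrow> (point3 \<Rightarrow> real) \<Rightarrow> bool" where
  "C1_test phi phit phix phiy \<longleftrightarrow>
     (\<forall>z. (phi has_derivative
             (\<lambda>(s, a, b). phit z * s + phix z * a + phiy z * b)) (at z)) \<and>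
     continuous_on UNIV phit \<and> continuous_on UNIV phix \<and> continuous_on UNIV phiy"

definition local_max_at :: "(point3 \<Rightarrow> real) \<Rightarrow> point3 \<Rightarrow> bool" where
  "local_max_at f z \<longleftrightarrow> (\<exists>e>0. \<forall>w\<in>ball z e. f w \<le> f z)"

definition local_min_at :: "(point3 \<Rightarrow> real) \<Rightarrow> point3 \<Rightarrow> bool" where
  "local_min_at f z \<longleftrightarrow> (\<exists>e>0. \<forall>w\<in>ball z e. f z \<le> f w)"

text \<open>Classical viscosity solution of
  u_t = (|u_x| - |u_y|) xi'(t) on (0,T) x R^2, u(0,x,y) = u0(x,y),
  for a C^1 driving path xi with derivative xi', in the class of
  uniformly continuous functions on [0,T] x R^2 (the uniqueness class).\<close>
definition visc_sol :: "real \<Rightarrow> (real \<Rightarrow> real) \<Rightarrow> (real \<times> real \<Rightarrow> real)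
    \<Rightarrow> (point3 \<Rightarrow> real) \<Rightarrow> bool" where
  "visc_sol T xi' u0 u \<longleftrightarrow>
     uniformly_continuous_on ({0..T} \<times> UNIV) u \<and>
     (\<forall>x y. u (0, x, y) = u0 (x, y)) \<and>
     (\<forall>t x y phi phit phix phiy. 0 < t \<and> t < T \<and> C1_test phi phit phix phiy \<longrightarrow>
        (local_max_at (\<lambda>w. u w - phi w) (t, x, y) \<longrightarrow>
           phit (t, x, y) \<le> (\<bar>phix (t, x, y)\<bar> - \<bar>phiy (t, x, y)\<bar>) * xi' t) \<and>
        (local_min_at (\<lambda>w. u w - phi w) (t, x, y) \<longrightarrow>
           phit (t, x, y) \<ge> (\<bar>phix (t, x, y)\<bar> - \<bar>phiy (t, x, y)\<bar>) * xi' t))"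

definition locally_uniform_limit :: "point3 set \<Rightarrow> (nat \<Rightarrow> point3 \<Rightarrow> real) \<Rightarrow> (point3 \<Rightarrow> real) \<Rightarrow> bool" where
  "locally_uniform_limit S us u \<longleftrightarrow>
     (\<forall>K. compact K \<and> K \<subseteq> S \<longrightarrow> uniform_limit K us u sequentially)"

definition LS_solution :: "real \<Rightarrow> (real \<Rightarrow> real) \<Rightarrow> (real \<times> real \<Rightarrow> real)
    \<Rightarrow> (point3 \<Rightarrow> real) \<Rightarrow> bool" where
  "LS_solution T xi u0 u \<longleftrightarrow>
     (\<forall>xis xis' us.
        (\<forall>k. C1_path T (xis k) (xis' k)) \<and>
        uniform_limit {0..T} xis xi sequentially \<and>
        (\<forall>k. visc_sol T (xis' k) u0 (us k)) \<longrightarrow>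
        locally_uniform_limit ({0..T} \<times> UNIV) us u)"

definition is_partition :: "real \<Rightarrow> nat \<Rightarrow> (nat \<Rightarrow> real) \<Rightarrow> bool" where
  "is_partition T n t \<longleftrightarrow> n \<ge> 1 \<and> t 0 = 0 \<and> t n = T \<and> (\<forall>i<n. t i \<le> t (Suc i))"

definition total_variation :: "real \<Rightarrow> (real \<Rightarrow> real) \<Rightarrow> ereal" where
  "total_variation T xi =
     (SUP p \<in> {(n, t). is_partition T n t}.
        ereal (\<Sum>i<fst p. \<bar>xi (snd p (Suc i)) - xi (snd p i)\<bar>))"

end

theory Submission
  imports Defs
begin

text \<open>For a Lipschitz path write \<open>\<xi> = p - q\<close> with \<open>p, q\<close> nondecreasing. The equation is then the
  Isaacs equation of a game: between times \<open>s \<le> t\<close> the maximizer displaces \<open>(x, y)\<close> by at most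
  \<open>(p t - p s, q t - q s)\<close> and the minimizer by at most \<open>(q t - q s, p t - p s)\<close>. Perron's method,
  applied to the dynamic programming inequalities instead of the equation, produces a function that
  satisfies them in both directions and hence is a viscosity solution, without any comparison
  principle. The lower inequality shows that the value stays above \<open>\<bar>x - y\<bar>\<close> and that a bound
  \<open>u \<ge> c\<close> on \<open>{x \<ge> r}\<close> is transported to \<open>{x \<ge> r - \<Delta>\<xi>}\<close>, and one on \<open>{y \<ge> r}\<close> to \<open>{y \<ge> r + \<Delta>\<xi>}\<close>.
  Since \<open>u \<ge> \<bar>x - y\<bar>\<close>, a bound \<open>u \<ge> c\<close> on the quadrant \<open>{min x y \<ge> r}\<close> extends to both half planes
  with \<open>r\<close> replaced by \<open>r + c\<close>; so each partition step moves the quadrant down by \<open>\<bar>\<Delta>\<xi>\<bar> - c\<close>. Finally a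
  continuous path is approximated by polynomials.\<close>

section \<open>Displacements\<close>

definition rect :: "real \<Rightarrow> real \<Rightarrow> (real \<times> real) set" where
  "rect a b = {-a..a} \<times> {-b..b}"

lemma mem_rect: "(x, y) \<in> rect a b \<longleftrightarrow> \<bar>x\<bar> \<le> a \<and> \<bar>y\<bar> \<le> b"
  by (auto simp: rect_def)

lemma zero_in_rect: "0 \<le> a \<Longrightarrow> 0 \<le> b \<Longrightarrow> 0 \<in> rect a b"
  by (simp add: zero_prod_def mem_rect)

lemma rect_add: "k \<in> rect a b \<Longrightarrow> l \<in> rect c d \<Longrightarrow> k + l \<in> rect (a + c) (b + d)"
  by (cases k; cases l) (auto simp: mem_rect)

lemma norm_rect_le: "k \<in> rect a b \<Longrightarrow> norm k \<le> a + b"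
  using norm_Pair_le[of "fst k" "snd k"] by (cases k) (auto simp: mem_rect)

lemma interval_direction:
  fixes a :: real
  assumes "\<bar>x\<bar> \<le> a"
  obtains \<alpha> where "\<bar>\<alpha>\<bar> \<le> 1" "x = \<alpha> * a"
proof (cases "a = 0")
  case True
  then show ?thesis using assms that[of 0] by auto
next
  case False
  then show ?thesis using assms that[of "x / a"] by auto
qed

lemma rect_direction:
  assumes "k \<in> rect a b"
  obtains \<alpha> \<beta> where "\<bar>\<alpha>\<bar> \<le> 1" "\<bar>\<beta>\<bar> \<le> 1" "k = (\<alpha> * a, \<beta> * b)"
proof -
  obtain x y where k: "k = (x, y)" by (cases k)
  with assms have "\<bar>x\<bar> \<le> a" "\<bar>y\<bar> \<le> b" by (auto simp: mem_rect)
  then show ?thesis using k that by (metis interval_direction)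
qed

lemma direction_in_rect:
  assumes "\<bar>\<alpha>\<bar> \<le> 1" "\<bar>\<beta>\<bar> \<le> 1" "0 \<le> a" "0 \<le> b"
  shows "(\<alpha> * a, \<beta> * b) \<in> rect a b"
  using assms by (auto simp: mem_rect abs_mult mult_left_le_one_le)

text \<open>Splitting in proportion to the side lengths works, both summands keeping the direction
  of \<open>k\<close>. It lets a displacement over a time interval be cut at an intermediate
  time.\<close>

lemma rect_add_split:
  assumes "k \<in> rect (a + c) (b + d)" "0 \<le> a" "0 \<le> b" "0 \<le> c" "0 \<le> d"
  obtains k1 k2 where "k1 \<in> rect a b" "k2 \<in> rect c d" "k = k1 + k2"
proof -
  obtain \<alpha> \<beta> where "\<bar>\<alpha>\<bar> \<le> 1" "\<bar>\<beta>\<bar> \<le> 1" and k: "k = (\<alpha> * (a + c), \<beta> * (b + d))"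
    using assms(1) by (rule rect_direction)
  then show ?thesis
    using assms
    by (intro that[of "(\<alpha> * a, \<beta> * b)" "(\<alpha> * c, \<beta> * d)"])
       (auto intro: direction_in_rect simp: distrib_left)
qed

text \<open>At large scale a uniformly continuous function grows at most linearly: \<open>h\<close>
  is cut into short steps, each raising \<open>f\<close> by at most 1. This bounds the sets whose
  infima and suprema are taken below.\<close>

lemma uniformly_continuous_translation_bound:
  fixes f :: "'a::real_normed_vector \<Rightarrow> real"
  assumes "uniformly_continuous_on UNIV f"
  shows "\<exists>C\<ge>0. \<forall>z h. norm h \<le> D \<longrightarrow> f (z + h) \<le> f z + C"
proof -
  obtain d where "d > 0" and d: "\<And>z z'. dist z' z < d \<Longrightarrow> dist (f z') (f z) < 1"
    using assms unfolding uniformly_continuous_on_def by (metis UNIV_I zero_less_one)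
  have step: "f (z + h) \<le> f z + 1" if "norm h < d" for z h
    using d[of "z + h" z] that by (simp add: dist_norm)
  \<comment> \<open>Steps of length \<open>d / 2\<close> stay strictly inside the modulus; the
    induction peels off one of \<open>Suc n\<close> equal pieces of \<open>h\<close>.\<close>
  have many: "norm h \<le> real n * (d / 2) \<Longrightarrow> f (z + h) \<le> f z + real n" for n z h
  proof (induction n arbitrary: z h)
    case (Suc n)
    define g where "g = (1 / real (Suc n)) *\<^sub>R h"
    have "norm g \<le> d / 2"
      using Suc.prems by (simp add: g_def field_simps)
    moreover have "h - g = (real n / real (Suc n)) *\<^sub>R h"
      unfolding g_def scaleR_left_diff_distrib[symmetric, of 1, simplified scaleR_one]
      by (simp add: field_simps flip: scaleR_left_diff_distrib)
    then have "norm (h - g) = real n * (norm h / real (Suc n))" by simp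
    then have "norm (h - g) \<le> real n * (d / 2)"
      using Suc.prems by (simp only:) (intro mult_left_mono, auto simp: field_simps)
    ultimately show ?case
      using Suc.IH[of "h - g" "z + g"] step[of g z] \<open>d > 0\<close> by (simp add: algebra_simps)
  qed simp
  obtain n where "D \<le> real n * (d / 2)"
    using \<open>d > 0\<close> ex_less_of_nat_mult[of "d / 2" D] by (auto intro: less_imp_le)
  then show ?thesis using many by (intro exI[of _ "real n"]) (meson of_nat_0_le_iff order_trans)
qed

section \<open>Dynamic programming inequalities\<close>

text \<open>Play runs back from \<open>t\<close> to \<open>s\<close>, and the maximizer answers
  \<open>l\<close> with \<open>k\<close>. The slack \<open>e\<close> makes up for optima that are
  not attained and lets the inequality survive pointwise suprema.\<close>

definition sub_dpp :: "real \<Rightarrow> (real \<Rightarrow> real) \<Rightarrow> (real \<Rightarrow> real) \<Rightarrow> (point3 \<Rightarrow> real) \<Rightarrow> bool" where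
  "sub_dpp T p q w \<longleftrightarrow>
     (\<forall>s t z l e. 0 \<le> s \<and> s \<le> t \<and> t \<le> T \<and> l \<in> rect (q t - q s) (p t - p s) \<and> 0 < e \<longrightarrow>
        (\<exists>k\<in>rect (p t - p s) (q t - q s). w (t, z) \<le> w (s, z + k + l) + e))"

lemma sub_dppD:
  assumes "sub_dpp T p q w" "0 \<le> s" "s \<le> t" "t \<le> T" "l \<in> rect (q t - q s) (p t - p s)" "0 < e"
  obtains k where "k \<in> rect (p t - p s) (q t - q s)" "w (t, z) \<le> w (s, z + k + l) + e"
  using assms unfolding sub_dpp_def by blast

text \<open>Negating the value exchanges the players, that is, \<open>p\<close> and \<open>q\<close>.\<close>

lemma super_dppD:
  assumes "sub_dpp T q p (\<lambda>w. - u w)" "0 \<le> s" "s \<le> t" "t \<le> T"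
    "k \<in> rect (p t - p s) (q t - q s)" "0 < e"
  obtains l where "l \<in> rect (q t - q s) (p t - p s)" "u (s, z + k + l) - e \<le> u (t, z)"
proof -
  obtain l where l: "l \<in> rect (q t - q s) (p t - p s)" "- u (t, z) \<le> - u (s, z + l + k) + e"
    using sub_dppD[OF assms(1-6)] by metis
  then have "u (s, z + k + l) - e \<le> u (t, z)" by (simp add: add_ac)
  with l(1) show ?thesis by (rule that)
qed

text \<open>All pairs \<open>h\<close>, \<open>c\<close> are treated at once: small shifts yield
  continuity in space, large ones yield bounds. Such one-sided inequalities pass to suprema and
  infima.\<close>

definition inherits_modulus :: "real \<Rightarrow> (real \<times> real \<Rightarrow> real) \<Rightarrow> (point3 \<Rightarrow> real) \<Rightarrow> bool" where
  "inherits_modulus T f w \<longleftrightarrow>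
     (\<forall>h c. (\<forall>z. f (z + h) \<le> f z + c) \<longrightarrow> (\<forall>t\<in>{0..T}. \<forall>z. w (t, z + h) \<le> w (t, z) + c))"

lemma inherits_modulusD:
  "inherits_modulus T f w \<Longrightarrow> (\<And>z. f (z + h) \<le> f z + c) \<Longrightarrow> 0 \<le> t \<Longrightarrow> t \<le> T \<Longrightarrow>
    w (t, z + h) \<le> w (t, z) + c"
  unfolding inherits_modulus_def by (meson atLeastAtMost_iff)

section \<open>Perron construction\<close>

locale dpp_perron =
  fixes T :: real and p q :: "real \<Rightarrow> real" and f :: "real \<times> real \<Rightarrow> real"
  assumes T_nonneg: "0 \<le> T"
    and p_mono: "\<And>s t. 0 \<le> s \<Longrightarrow> s \<le> t \<Longrightarrow> t \<le> T \<Longrightarrow> p s \<le> p t"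
    and q_mono: "\<And>s t. 0 \<le> s \<Longrightarrow> s \<le> t \<Longrightarrow> t \<le> T \<Longrightarrow> q s \<le> q t"
    and f_ucont: "uniformly_continuous_on UNIV f"
begin

abbreviation K :: "real \<Rightarrow> real \<Rightarrow> (real \<times> real) set" where
  "K s t \<equiv> rect (p t - p s) (q t - q s)"

abbreviation L :: "real \<Rightarrow> real \<Rightarrow> (real \<times> real) set" where
  "L s t \<equiv> rect (q t - q s) (p t - p s)"

lemma zero_in_K: "0 \<le> s \<Longrightarrow> s \<le> t \<Longrightarrow> t \<le> T \<Longrightarrow> 0 \<in> K s t"
  and zero_in_L: "0 \<le> s \<Longrightarrow> s \<le> t \<Longrightarrow> t \<le> T \<Longrightarrow> 0 \<in> L s t"
  by (simp_all add: zero_in_rect p_mono q_mono)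

lemma K_add: "k \<in> K s t \<Longrightarrow> k' \<in> K t r \<Longrightarrow> k + k' \<in> K s r"
  and L_add: "l \<in> L s t \<Longrightarrow> l' \<in> L t r \<Longrightarrow> l + l' \<in> L s r"
  using rect_add[of k "p t - p s" "q t - q s" k' "p r - p t" "q r - q t"]
    rect_add[of l "q t - q s" "p t - p s" l' "q r - q t" "p r - p t"]
  by simp_all

lemma L_split:
  assumes "l \<in> L s r" "0 \<le> s" "s \<le> t" "t \<le> r" "r \<le> T"
  obtains l1 l2 where "l1 \<in> L s t" "l2 \<in> L t r" "l = l1 + l2"
proof (rule rect_add_split[of l "q t - q s" "q r - q t" "p t - p s" "p r - p t"])
  show "l \<in> rect (q t - q s + (q r - q t)) (p t - p s + (p r - p t))" using assms by simp
qed (use assms that in \<open>simp_all add: p_mono q_mono\<close>)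

text \<open>Perron's class of subsolutions, with dynamic programming in place of the equation. The
  modulus is a membership condition so that the supremum has it by construction.\<close>

definition family :: "(point3 \<Rightarrow> real) set" where
  "family = {w. (\<forall>z. w (0, z) \<le> f z) \<and> inherits_modulus T f w \<and> sub_dpp T p q w}"

section \<open>Committed strategies of the maximizer\<close>

definition control_path :: "real \<Rightarrow> real \<times> real \<Rightarrow> real \<Rightarrow> real \<times> real" where
  "control_path s \<alpha> t = (fst \<alpha> * (p t - p s), snd \<alpha> * (q t - q s))"

text \<open>The value when the maximizer commits, from time \<open>s\<close> on, to a straight-line control in the
  direction \<open>(\<alpha>, \<beta>)\<close> and receives the payoff \<open>g\<close> at time \<open>s\<close>.\<close>

definition committed :: "real \<Rightarrow> real \<times> real \<Rightarrow> (real \<times> real \<Rightarrow> real) \<Rightarrow> point3 \<Rightarrow> real" where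
  "committed s \<alpha> g = (\<lambda>(t, z). INF l\<in>L s t. g (z + control_path s \<alpha> t + l))"

definition f_modulus :: "(real \<times> real \<Rightarrow> real) \<Rightarrow> bool" where
  "f_modulus g \<longleftrightarrow> (\<forall>h c. (\<forall>z. f (z + h) \<le> f z + c) \<longrightarrow> (\<forall>z. g (z + h) \<le> g z + c))"

lemma f_modulus_self: "f_modulus f"
  by (simp add: f_modulus_def)

lemma f_modulus_slice: "inherits_modulus T f w \<Longrightarrow> 0 \<le> s \<Longrightarrow> s \<le> T \<Longrightarrow> f_modulus (\<lambda>z. w (s, z))"
  by (auto simp: f_modulus_def inherits_modulus_def)

text \<open>The shift by \<open>- l\<close> leads from \<open>z + l\<close> back to
  \<open>z\<close>, so the modulus of \<open>f\<close> for \<open>- l\<close> bounds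
  \<open>g (z + l)\<close> from below.\<close>

lemma bdd_below_committed:
  assumes "f_modulus g"
  shows "bdd_below ((\<lambda>l. g (z + l)) ` rect a b)"
proof -
  obtain C where C: "\<And>z h. norm h \<le> a + b \<Longrightarrow> f (z + h) \<le> f z + C"
    using uniformly_continuous_translation_bound[OF f_ucont] by metis
  have "g z - C \<le> g (z + l)" if "l \<in> rect a b" for l
  proof -
    have "f (z + - l) \<le> f z + C" for z
      using norm_rect_le[OF that] by (intro C) simp
    then have "g (z + l + - l) \<le> g (z + l) + C"
      using assms unfolding f_modulus_def by blast
    then show ?thesis by (simp add: add.assoc)
  qed
  then show ?thesis by (intro bdd_belowI[where m = "g z - C"]) auto
qed

lemma committed_le:
  assumes "f_modulus g" "l \<in> L s t"
  shows "committed s \<alpha> g (t, z) \<le> g (z + control_path s \<alpha> t + l)"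
  unfolding committed_def prod.case using assms by (intro cINF_lower bdd_below_committed)

lemma committed_ge:
  assumes "L s t \<noteq> {}" "\<And>l. l \<in> L s t \<Longrightarrow> m \<le> g (z + control_path s \<alpha> t + l)"
  shows "m \<le> committed s \<alpha> g (t, z)"
  unfolding committed_def prod.case using assms by (intro cINF_greatest)

lemma committed_modulus:
  assumes "f_modulus g" "0 \<le> s" "s \<le> t" "t \<le> T" "\<And>z. f (z + h) \<le> f z + c"
  shows "committed s \<alpha> g (t, z + h) \<le> committed s \<alpha> g (t, z) + c"
proof -
  have "committed s \<alpha> g (t, z + h) - c \<le> committed s \<alpha> g (t, z)"
  proof (rule committed_ge)
    show "L s t \<noteq> {}" using zero_in_L assms by blast
    fix l assume "l \<in> L s t"
    then have "committed s \<alpha> g (t, z + h) \<le> g (z + h + control_path s \<alpha> t + l)"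
      using assms by (intro committed_le)
    also have "\<dots> = g (z + control_path s \<alpha> t + l + h)"
      by (simp add: add_ac)
    also have "\<dots> \<le> g (z + control_path s \<alpha> t + l) + c"
      using assms unfolding f_modulus_def by blast
    finally show "committed s \<alpha> g (t, z + h) - c \<le> g (z + control_path s \<alpha> t + l)" by simp
  qed
  then show ?thesis by simp
qed

lemma control_path_step:
  assumes "\<bar>fst \<alpha>\<bar> \<le> 1" "\<bar>snd \<alpha>\<bar> \<le> 1" "0 \<le> r" "r \<le> t" "t \<le> T"
  shows "control_path s \<alpha> t - control_path s \<alpha> r \<in> K r t"
proof -
  have "control_path s \<alpha> t - control_path s \<alpha> r = (fst \<alpha> * (p t - p r), snd \<alpha> * (q t - q r))"
    by (simp add: control_path_def algebra_simps)
  then show ?thesis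
    using assms by (simp add: direction_in_rect p_mono q_mono)
qed

lemma control_path_in_K:
  assumes "\<bar>fst \<alpha>\<bar> \<le> 1" "\<bar>snd \<alpha>\<bar> \<le> 1" "0 \<le> s" "s \<le> t" "t \<le> T"
  shows "control_path s \<alpha> t \<in> K s t"
  using assms unfolding control_path_def by (simp add: direction_in_rect p_mono q_mono)

text \<open>The maximizer's reply over \<open>[r, t]\<close> is the increment of the fixed control
  path, whatever \<open>l\<close> is. A minimizer's displacement over \<open>[s, r]\<close> followed
  by \<open>l\<close> is one over \<open>[s, t]\<close>, so the infimum on the left ranges over it
  too.\<close>

lemma committed_step:
  assumes "f_modulus g" "\<bar>fst \<alpha>\<bar> \<le> 1" "\<bar>snd \<alpha>\<bar> \<le> 1"
    "0 \<le> s" "s \<le> r" "r \<le> t" "t \<le> T" "l \<in> L r t"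
  shows "committed s \<alpha> g (t, z)
    \<le> committed s \<alpha> g (r, z + (control_path s \<alpha> t - control_path s \<alpha> r) + l)"
proof (rule committed_ge)
  show "L s r \<noteq> {}" using zero_in_L[of s r] assms by auto
  fix m assume "m \<in> L s r"
  then have "m + l \<in> L s t" using assms L_add by blast
  then have "committed s \<alpha> g (t, z) \<le> g (z + control_path s \<alpha> t + (m + l))"
    by (rule committed_le[OF assms(1)])
  then show "committed s \<alpha> g (t, z)
    \<le> g (z + (control_path s \<alpha> t - control_path s \<alpha> r) + l + control_path s \<alpha> r + m)"
    by (simp add: algebra_simps)
qed

lemma committed_initial: "committed s \<alpha> g (s, z) = g z"
proof -
  have "L s s = {0}" by (auto simp: rect_def zero_prod_def)
  then show ?thesis by (simp add: committed_def control_path_def flip: zero_prod_def)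
qed

text \<open>Direction 0 means that the maximizer never moves. The point is that the family is
  nonempty, as suprema over reals require.\<close>

lemma committed_in_family: "committed 0 0 f \<in> family"
  unfolding family_def inherits_modulus_def sub_dpp_def
proof (intro CollectI conjI allI impI ballI; (elim conjE)?)
  fix s t e :: real and z l :: "real \<times> real"
  assume *: "0 \<le> s" "s \<le> t" "t \<le> T" "l \<in> L s t" "0 < e"
  then have "committed 0 0 f (t, z)
      \<le> committed 0 0 f (s, z + (control_path 0 0 t - control_path 0 0 s) + l) + e"
    using committed_step[OF f_modulus_self, of 0 0 s t l z] by simp
  moreover have "control_path 0 0 t - control_path 0 0 s \<in> K s t"
    using * by (intro control_path_step) auto
  ultimately show "\<exists>k\<in>K s t. committed 0 0 f (t, z) \<le> committed 0 0 f (s, z + k + l) + e"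
    by blast
next
  fix h c t z assume "\<forall>z. f (z + h) \<le> f z + c" "t \<in> {0..T}"
  then show "committed 0 0 f (t, z + h) \<le> committed 0 0 f (t, z) + c"
    by (intro committed_modulus f_modulus_self) (simp_all del: split_paired_All)
qed (simp add: committed_initial)

section \<open>The supremum of the family\<close>

definition game_value :: "point3 \<Rightarrow> real" where
  "game_value x = (SUP w\<in>family. w x)"

text \<open>Against a minimizer who stands still, a member at time \<open>t\<close> is controlled by
  its values at time 0, hence by \<open>f\<close>, within distance \<open>D\<close>.\<close>

lemma bdd_above_family:
  assumes "0 \<le> t" "t \<le> T"
  shows "bdd_above ((\<lambda>w. w (t, z)) ` family)"
proof -
  define D where "D = p t - p 0 + (q t - q 0)"
  obtain C where C: "\<And>z h. norm h \<le> D \<Longrightarrow> f (z + h) \<le> f z + C"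
    using uniformly_continuous_translation_bound[OF f_ucont] by metis
  have "w (t, z) \<le> f z + C + 1" if "w \<in> family" for w
  proof -
    have w: "sub_dpp T p q w" "\<And>z. w (0, z) \<le> f z" using that by (auto simp: family_def)
    obtain k where k: "k \<in> K 0 t" "w (t, z) \<le> w (0, z + k + 0) + 1"
      using sub_dppD[OF w(1), of 0 t 0 1] zero_in_L[of 0 t] assms by (metis order_refl zero_less_one)
    then show ?thesis
      using w(2)[of "z + k"] C[of k z] norm_rect_le[OF k(1)] by (simp add: D_def)
  qed
  then show ?thesis by (intro bdd_aboveI) auto
qed

lemma le_value: "w \<in> family \<Longrightarrow> 0 \<le> t \<Longrightarrow> t \<le> T \<Longrightarrow> w (t, z) \<le> game_value (t, z)"
  unfolding game_value_def by (intro cSUP_upper bdd_above_family)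

lemma value_le: "(\<And>w. w \<in> family \<Longrightarrow> w x \<le> m) \<Longrightarrow> game_value x \<le> m"
  unfolding game_value_def using committed_in_family by (intro cSUP_least) auto

lemma value_approx:
  assumes "0 < e" "0 \<le> t" "t \<le> T"
  obtains w where "w \<in> family" "game_value (t, z) < w (t, z) + e"
proof -
  have "\<exists>w\<in>family. game_value (t, z) - e < w (t, z)"
    unfolding game_value_def using assms committed_in_family
    by (subst less_cSUP_iff[symmetric]) (auto intro!: bdd_above_family)
  then show ?thesis using that by (auto simp: algebra_simps)
qed

lemma value_initial: "game_value (0, z) = f z"
proof (rule antisym)
  show "game_value (0, z) \<le> f z" by (rule value_le) (simp add: family_def del: split_paired_All)
  show "f z \<le> game_value (0, z)"
    using le_value[OF committed_in_family, of 0 z] T_nonneg by (simp add: committed_initial)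
qed

lemma value_modulus: "inherits_modulus T f game_value"
  unfolding inherits_modulus_def
proof (intro allI impI ballI)
  fix h c t z assume *: "\<forall>z. f (z + h) \<le> f z + c" "t \<in> {0..T}"
  show "game_value (t, z + h) \<le> game_value (t, z) + c"
  proof (rule value_le)
    fix w assume w: "w \<in> family"
    then have "w (t, z + h) \<le> w (t, z) + c"
      using * by (auto simp: family_def intro: inherits_modulusD)
    then show "w (t, z + h) \<le> game_value (t, z) + c" using le_value[OF w, of t z] * by simp
  qed
qed

text \<open>A nearly maximal member stands in for the supremum at \<open>(t, z)\<close>: half of the
  slack pays for that choice, half for the member's own inequality.\<close>

lemma value_sub_dpp: "sub_dpp T p q game_value"
  unfolding sub_dpp_def
proof (intro allI impI; elim conjE)
  fix s t e :: real and z l :: "real \<times> real"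
  assume *: "0 \<le> s" "s \<le> t" "t \<le> T" "l \<in> L s t" "0 < e"
  obtain w where w: "w \<in> family" "game_value (t, z) < w (t, z) + e / 2"
    using value_approx[of "e / 2" t z] * by auto
  then have "sub_dpp T p q w" by (simp add: family_def)
  then obtain k where k: "k \<in> K s t" "w (t, z) \<le> w (s, z + k + l) + e / 2"
    by (rule sub_dppD[where s = s and t = t and l = l and e = "e / 2"]) (use * in auto)
  with w le_value[OF w(1), of s "z + k + l"] *
  show "\<exists>k\<in>K s t. game_value (t, z) \<le> game_value (s, z + k + l) + e" by (intro bexI[of _ k]) auto
qed

text \<open>Raising the value by a committed strategy stays inside the family, so by maximality the
  committed value lies below it.\<close>

lemma committed_le_value:
  assumes "0 \<le> s" "s \<le> t" "t \<le> T" "\<bar>fst \<alpha>\<bar> \<le> 1" "\<bar>snd \<alpha>\<bar> \<le> 1"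
  shows "committed s \<alpha> (\<lambda>z. game_value (s, z)) (t, z) \<le> game_value (t, z)"
proof -
  define g where "g = (\<lambda>z. game_value (s, z))"
  have g: "f_modulus g"
    unfolding g_def using assms by (intro f_modulus_slice value_modulus) auto
  \<comment> \<open>At time \<open>s\<close> the committed value equals \<open>game_value\<close>,
    so the modification sets in consistently.\<close>
  define W :: "point3 \<Rightarrow> real" where
    "W = (\<lambda>(t, z). if s \<le> t then max (game_value (t, z)) (committed s \<alpha> g (t, z)) else game_value (t, z))"
  have value_le_W: "game_value (t, z) \<le> W (t, z)" for t z by (simp add: W_def)
  have "sub_dpp T p q W"
    unfolding sub_dpp_def
  proof (intro allI impI; elim conjE)
    fix r t e :: real and z l :: "real \<times> real"
    assume *: "0 \<le> r" "r \<le> t" "t \<le> T" "l \<in> L r t" "0 < e"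
    show "\<exists>k\<in>K r t. W (t, z) \<le> W (r, z + k + l) + e"
    proof (cases "W (t, z) = game_value (t, z)")
      case True
      obtain k where "k \<in> K r t" "game_value (t, z) \<le> game_value (r, z + k + l) + e"
        using sub_dppD[OF value_sub_dpp *] by blast
      then show ?thesis using True value_le_W[of r "z + k + l"] by (intro bexI[of _ k]) auto
    next
      case False
      then have st: "s \<le> t" and Wt: "W (t, z) = committed s \<alpha> g (t, z)"
        by (auto simp: W_def max_def split: if_splits)
      show ?thesis
      proof (cases "s \<le> r")
        case True
        let ?k = "control_path s \<alpha> t - control_path s \<alpha> r"
        have "W (t, z) \<le> committed s \<alpha> g (r, z + ?k + l)"
          unfolding Wt using g assms * True by (intro committed_step)
        also have "\<dots> \<le> W (r, z + ?k + l) + e"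
          using True \<open>0 < e\<close> by (simp add: W_def)
        finally show ?thesis using control_path_step[of \<alpha> r t s] assms * by blast
      next
        case False
        \<comment> \<open>Here \<open>r < s\<close>: the committed strategy covers
          \<open>[s, t]\<close> against \<open>l2\<close>, and the inequality for
          \<open>game_value\<close> supplies the reply to \<open>l1\<close> on
          \<open>[r, s]\<close>.\<close>
        then obtain l1 l2 where l: "l1 \<in> L r s" "l2 \<in> L s t" "l = l1 + l2"
          using L_split[where s = r and t = s and r = t and l = l] * st by (metis linear)
        obtain k where k: "k \<in> K r s"
          "game_value (s, z + control_path s \<alpha> t + l2) \<le> game_value (r, z + control_path s \<alpha> t + l2 + k + l1) + e"
          by (rule sub_dppD[OF value_sub_dpp, where s = r and t = s and l = l1 and e = e])
             (use * assms False l in auto)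
        have "W (t, z) \<le> g (z + control_path s \<alpha> t + l2)"
          unfolding Wt using g l by (intro committed_le)
        also have "\<dots> \<le> game_value (r, z + control_path s \<alpha> t + l2 + k + l1) + e"
          unfolding g_def by (rule k)
        also have "z + control_path s \<alpha> t + l2 + k + l1 = z + (k + control_path s \<alpha> t) + l"
          unfolding l by (simp add: add_ac)
        also have "game_value (r, \<dots>) + e \<le> W (r, \<dots>) + e" using value_le_W by simp
        finally show ?thesis
          using K_add[OF k(1) control_path_in_K[of \<alpha> s t]] assms * st by blast
      qed
    qed
  qed
  moreover have "inherits_modulus T f W"
    unfolding inherits_modulus_def
  proof (intro allI impI ballI)
    fix h c t z assume *: "\<forall>z. f (z + h) \<le> f z + c" "t \<in> {0..T}"
    have "game_value (t, z + h) \<le> game_value (t, z) + c"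
      using * by (intro inherits_modulusD[OF value_modulus]) auto
    moreover have "committed s \<alpha> g (t, z + h) \<le> committed s \<alpha> g (t, z) + c" if "s \<le> t"
      using * assms that by (intro committed_modulus g) auto
    ultimately show "W (t, z + h) \<le> W (t, z) + c"
      by (auto simp: W_def)
  qed
  moreover have "W (0, z) \<le> f z" for z
    using assms committed_initial[of 0 \<alpha> g z] by (auto simp: W_def value_initial g_def)
  ultimately have "W \<in> family" by (simp add: family_def)
  then have "W (t, z) \<le> game_value (t, z)" using assms by (intro le_value) auto
  then show ?thesis using assms by (simp add: W_def g_def)
qed

text \<open>If some \<open>k\<close> beat the value by \<open>e\<close> against every reply,
  committing to the direction of \<open>k\<close> would yield at least
  \<open>game_value (t, z) + e\<close>, contradicting \<open>committed_le_value\<close>.\<close>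

lemma value_super_dpp: "sub_dpp T q p (\<lambda>x. - game_value x)"
  unfolding sub_dpp_def
proof (intro allI impI; elim conjE)
  fix s t e :: real and z k :: "real \<times> real"
  assume *: "0 \<le> s" "s \<le> t" "t \<le> T" "k \<in> K s t" "0 < e"
  obtain \<alpha> \<beta> where \<alpha>: "\<bar>\<alpha>\<bar> \<le> 1" "\<bar>\<beta>\<bar> \<le> 1" "k = (\<alpha> * (p t - p s), \<beta> * (q t - q s))"
    using *(4) by (rule rect_direction)
  then have k: "k = control_path s (\<alpha>, \<beta>) t" by (simp add: control_path_def)
  show "\<exists>l\<in>L s t. - game_value (t, z) \<le> - game_value (s, z + l + k) + e"
  proof (rule ccontr)
    assume "\<not> ?thesis"
    then have "game_value (t, z) + e \<le> game_value (s, z + k + l)" if "l \<in> L s t" for l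
      using that by (force simp: add_ac)
    then have "game_value (t, z) + e \<le> committed s (\<alpha>, \<beta>) (\<lambda>z. game_value (s, z)) (t, z)"
      using zero_in_L[of s t] * unfolding k by (intro committed_ge) auto
    also have "\<dots> \<le> game_value (t, z)" using * \<alpha> by (intro committed_le_value) auto
    finally show False using \<open>0 < e\<close> by simp
  qed
qed

text \<open>Continuity in space is the modulus of \<open>f\<close>. In time, each inequality with
  the opponent standing still compares two times at the cost of a displacement no longer than the
  increment of \<open>p + q\<close>.\<close>

lemma inherited_modulus_uniformly_continuous:
  assumes w: "inherits_modulus T f w" "sub_dpp T p q w" "sub_dpp T q p (\<lambda>x. - w x)"
    and p_cont: "continuous_on {0..T} p" and q_cont: "continuous_on {0..T} q"
  shows "uniformly_continuous_on ({0..T} \<times> UNIV) w"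
  unfolding uniformly_continuous_on_def
proof (intro allI impI)
  fix e :: real assume "0 < e"
  \<comment> \<open>Time will contribute at most \<open>2 * e'\<close> and space at most
    \<open>e'\<close>; the total \<open>e / 2\<close> is strictly below \<open>e\<close>.\<close>
  define e' where "e' = e / 6"
  have "0 < e'" using \<open>0 < e\<close> by (simp add: e'_def)
  obtain d where "0 < d" and d: "\<And>z z'. dist z' z < d \<Longrightarrow> dist (f z') (f z) < e'"
    using f_ucont \<open>0 < e'\<close> unfolding uniformly_continuous_on_def by (metis UNIV_I)
  have f: "f (z + h) \<le> f z + e'" if "norm h < d" for z h
    using d[of "z + h" z] that by (simp add: dist_norm)
  have space: "w (t, z + h) \<le> w (t, z) + e'" if "norm h < d" "0 \<le> t" "t \<le> T" for t z h
    using inherits_modulusD[OF w(1), of h e'] f that by blast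
  have "uniformly_continuous_on {0..T} (\<lambda>t. p t + q t)"
    using p_cont q_cont by (intro compact_uniformly_continuous continuous_on_add) auto
  then obtain d' where "0 < d'" and d':
    "\<And>s t. s \<in> {0..T} \<Longrightarrow> t \<in> {0..T} \<Longrightarrow> dist t s < d' \<Longrightarrow> dist (p t + q t) (p s + q s) < d"
    using \<open>0 < d\<close> unfolding uniformly_continuous_on_def by metis
  have small: "norm k < d" if "k \<in> K s t \<or> k \<in> L s t" "0 \<le> s" "s \<le> t" "t \<le> T" "t - s < d'" for s t k
  proof -
    have "norm k \<le> p t + q t - (p s + q s)"
      using that(1) norm_rect_le[of k "p t - p s" "q t - q s"] norm_rect_le[of k "q t - q s" "p t - p s"]
      by auto
    also have "\<dots> < d"
      using d'[of s t] that by (simp add: dist_real_def)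
    finally show ?thesis .
  qed
  have time: "\<bar>w (t, z) - w (s, z)\<bar> \<le> 2 * e'" if st: "0 \<le> s" "s \<le> t" "t \<le> T" "t - s < d'" for s t z
  proof -
    obtain k where k: "k \<in> K s t" "w (t, z) \<le> w (s, z + k + 0) + e'"
      by (rule sub_dppD[OF w(2) st(1-3) zero_in_L \<open>0 < e'\<close>]) (use st in auto)
    obtain l where l: "l \<in> L s t" "w (s, z + 0 + l) - e' \<le> w (t, z)"
      by (rule super_dppD[OF w(3) st(1-3) zero_in_K \<open>0 < e'\<close>]) (use st in auto)
    have "norm k < d" "norm (- l) < d" using k(1) l(1) st by (simp_all only: norm_minus_cancel) (blast intro: small)+
    then have "w (s, z + k) \<le> w (s, z) + e'" "w (s, z + l + - l) \<le> w (s, z + l) + e'"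
      using st by (intro space; simp)+
    with k(2) l(2) show ?thesis by (simp add: abs_le_iff algebra_simps)
  qed
  show "\<exists>d>0. \<forall>x\<in>{0..T} \<times> UNIV. \<forall>x'\<in>{0..T} \<times> UNIV. dist x' x < d \<longrightarrow> dist (w x') (w x) < e"
  proof (intro exI[of _ "min d d'"] conjI ballI impI)
    show "0 < min d d'" using \<open>0 < d\<close> \<open>0 < d'\<close> by simp
    fix x x' :: point3 assume xx: "x \<in> {0..T} \<times> UNIV" "x' \<in> {0..T} \<times> UNIV" "dist x' x < min d d'"
    obtain s z where x: "x = (s, z)" by (cases x)
    obtain t z' where x': "x' = (t, z')" by (cases x')
    have st: "0 \<le> s" "s \<le> T" "0 \<le> t" "t \<le> T" using xx x x' by auto
    have "dist t s < d'" "dist z' z < d"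
      using xx(3) dist_fst_le[of x' x] dist_snd_le[of x' x] by (auto simp: x x')
    then have "\<bar>t - s\<bar> < d'" and z: "norm (z' - z) < d" "norm (z - z') < d"
      by (auto simp: dist_real_def dist_norm norm_minus_commute)
    then have "\<bar>w (t, z') - w (s, z')\<bar> \<le> 2 * e'"
      using time[of s t z'] time[of t s z'] st by (cases "s \<le> t") (auto simp: abs_minus_commute)
    moreover have "\<bar>w (s, z') - w (s, z)\<bar> \<le> e'"
      using space[OF z(1), of s z] space[OF z(2), of s z'] st by (simp add: abs_le_iff)
    ultimately have "\<bar>w (t, z') - w (s, z)\<bar> < e"
      using \<open>0 < e\<close> unfolding e'_def by linarith
    then show "dist (w x') (w x) < e" by (simp add: x x' dist_real_def)
  qed
qed

end

section \<open>Viscosity solutions from dynamic programming\<close>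

lemma abs_mult_bound:
  fixes a k P :: real
  assumes "\<bar>k\<bar> \<le> P"
  shows "a * k \<le> \<bar>a\<bar> * P"
proof -
  have "a * k \<le> \<bar>a\<bar> * \<bar>k\<bar>" using abs_ge_self[of "a * k"] by (simp add: abs_mult)
  also have "\<dots> \<le> \<bar>a\<bar> * P" using assms by (simp add: mult_left_mono)
  finally show ?thesis .
qed

text \<open>First-order expansion over a short step back in time: the maximizer gains at most
  \<open>\<bar>B\<bar> * P + \<bar>C\<bar> * Q\<close>, the minimizer can take
  \<open>\<bar>B\<bar> * Q + \<bar>C\<bar> * P\<close>, and \<open>P - Q\<close> is an increment of
  \<open>xi\<close>. The paths stay general so that the negated value is served as well.\<close>

lemma sub_dpp_viscosity_inequality:
  fixes p q xi :: "real \<Rightarrow> real" and x y A B C :: real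
  assumes w: "sub_dpp T p q w"
    and p: "\<And>s t. 0 \<le> s \<Longrightarrow> s \<le> t \<Longrightarrow> t \<le> T \<Longrightarrow> 0 \<le> p t - p s \<and> p t - p s \<le> M * (t - s)"
    and q: "\<And>s t. 0 \<le> s \<Longrightarrow> s \<le> t \<Longrightarrow> t \<le> T \<Longrightarrow> 0 \<le> q t - q s \<and> q t - q s \<le> M * (t - s)"
    and pq: "\<And>s t. p t - p s - (q t - q s) = xi t - xi s"
    and t: "0 < t" "t \<le> T"
    and xi: "(xi has_real_derivative d) (at t within {0..T})"
    and phi: "(phi has_derivative (\<lambda>(s, a, b). A * s + B * a + C * b)) (at (t, x, y))"
    and max: "local_max_at (\<lambda>w'. w w' - phi w') (t, x, y)"
  shows "A \<le> (\<bar>B\<bar> - \<bar>C\<bar>) * d"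
proof -
  have "0 \<le> M"
  proof -
    have "0 \<le> M * (t - 0)" using p[of 0 t] t by linarith
    then show ?thesis using t by (simp add: zero_le_mult_iff)
  qed
  \<comment> \<open>The displacement from \<open>(t, x, y)\<close> will have norm at most
    \<open>m + 2 * (P + Q)\<close>, hence at most \<open>N * m\<close>.\<close>
  define N where "N = 1 + 4 * M"
  have "0 < N" using \<open>0 \<le> M\<close> by (simp add: N_def)
  have approx: "A \<le> (\<bar>B\<bar> - \<bar>C\<bar>) * d + e * (1 + N + \<bar>B\<bar> + \<bar>C\<bar>)" if "0 < e" for e
  proof -
    obtain r where "0 < r" and r: "\<And>v. v \<in> ball (t, x, y) r \<Longrightarrow> w v - phi v \<le> w (t, x, y) - phi (t, x, y)"
      using max unfolding local_max_at_def by blast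
    obtain d1 where "0 < d1" and d1: "\<And>v. norm (v - (t, x, y)) < d1 \<Longrightarrow>
        norm (phi v - phi (t, x, y) - (case v - (t, x, y) of (s, a, b) \<Rightarrow> A * s + B * a + C * b))
          \<le> e * norm (v - (t, x, y))"
      using phi \<open>0 < e\<close> unfolding has_derivative_at_alt by meson
    obtain d2 where "0 < d2" and d2: "\<And>s. s \<in> {0..T} \<Longrightarrow> norm (s - t) < d2 \<Longrightarrow>
        norm (xi s - xi t - d * (s - t)) \<le> e * norm (s - t)"
      using xi \<open>0 < e\<close> unfolding has_field_derivative_def has_derivative_within_alt by meson
    \<comment> \<open>Small enough to keep the displaced point within all three radii and
      \<open>s\<close> nonnegative; the factors 2 make the radius bounds strict.\<close>
    define m where "m = Min {d2 / 2, t, r / (2 * N), d1 / (2 * N)}"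
    have m: "0 < m" "m \<le> d2 / 2" "m \<le> t" "m \<le> r / (2 * N)" "m \<le> d1 / (2 * N)"
      using \<open>0 < d1\<close> \<open>0 < d2\<close> \<open>0 < r\<close> \<open>0 < N\<close> t by (simp_all add: m_def)
    have Nm: "N * m < r" "N * m < d1"
      using m \<open>0 < N\<close> \<open>0 < r\<close> \<open>0 < d1\<close> by (simp_all add: field_simps)
    define s where "s = t - m"
    have s: "0 \<le> s" "s \<le> t" "t - s = m" using m by (simp_all add: s_def)
    define P where "P = p t - p s"
    define Q where "Q = q t - q s"
    have P: "0 \<le> P" "P \<le> M * m" and Q: "0 \<le> Q" "Q \<le> M * m"
      using p[of s t] q[of s t] s t by (auto simp: P_def Q_def)
    \<comment> \<open>The minimizer's best move against the linear part
      \<open>B * a + C * b\<close>.\<close>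
    define l where "l = (- sgn B * Q, - sgn C * P)"
    have l: "l \<in> rect Q P"
      unfolding l_def using P Q by (intro direction_in_rect) (auto simp: abs_sgn_eq)
    \<comment> \<open>A slack of \<open>e * m\<close> is only \<open>e\<close> after division by
      \<open>m\<close>.\<close>
    obtain k where k: "k \<in> rect P Q" and wk: "w (t, (x, y)) \<le> w (s, (x, y) + k + l) + e * m"
      unfolding P_def Q_def
      by (rule sub_dppD[OF w s(1,2) t(2) l[unfolded P_def Q_def], where e = "e * m" and z = "(x, y)"])
         (use \<open>0 < e\<close> m in auto)
    obtain k1 k2 where k12: "k = (k1, k2)" by (cases k)
    have "B * k1 \<le> \<bar>B\<bar> * P" "C * k2 \<le> \<bar>C\<bar> * Q"
      using k by (simp_all add: k12 mem_rect abs_mult_bound)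
    define v where "v = (s, (x, y) + k + l)"
    have v: "v - (t, x, y) = (- m, k + l)" by (simp add: v_def s_def)
    have "norm (v - (t, x, y)) \<le> m + (norm k + norm l)"
      unfolding v using norm_Pair_le[of "- m" "k + l"] norm_triangle_ineq[of k l] m by simp
    also have "\<dots> \<le> N * m"
      using norm_rect_le[OF k] norm_rect_le[OF l] P Q by (simp add: N_def algebra_simps)
    finally have nv: "norm (v - (t, x, y)) \<le> N * m" .
    have "v \<in> ball (t, x, y) r"
      using nv Nm by (simp add: dist_norm norm_minus_commute)
    then have "phi (t, x, y) \<le> phi v + e * m"
      using r[of v] wk by (simp add: v_def)
    moreover have "phi v - phi (t, x, y) - (case v - (t, x, y) of (s, a, b) \<Rightarrow> A * s + B * a + C * b)
        \<le> e * (N * m)"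
    proof -
      have "norm (v - (t, x, y)) < d1" using nv Nm by linarith
      from d1[OF this] have "phi v - phi (t, x, y)
          - (case v - (t, x, y) of (s, a, b) \<Rightarrow> A * s + B * a + C * b) \<le> e * norm (v - (t, x, y))"
        unfolding real_norm_def by (rule abs_le_D1)
      also have "\<dots> \<le> e * (N * m)" using nv \<open>0 < e\<close> by simp
      finally show ?thesis .
    qed
    moreover have "(case v - (t, x, y) of (s, a, b) \<Rightarrow> A * s + B * a + C * b)
        = - A * m + (B * k1 + C * k2) - (\<bar>B\<bar> * Q + \<bar>C\<bar> * P)"
    proof -
      have "B * (sgn B * Q) = \<bar>B\<bar> * Q" "C * (sgn C * P) = \<bar>C\<bar> * P"
        by (simp_all add: abs_sgn)
      moreover have "(case (- m, k + l) of (s, a, b) \<Rightarrow> A * s + B * a + C * b)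
          = - A * m + (B * k1 + C * k2) - (B * (sgn B * Q) + C * (sgn C * P))"
        by (simp add: k12 l_def right_diff_distrib)
      ultimately show ?thesis unfolding v by (simp only:)
    qed
    ultimately have *: "A * m \<le> (\<bar>B\<bar> - \<bar>C\<bar>) * (P - Q) + e * (1 + N) * m"
      using \<open>B * k1 \<le> \<bar>B\<bar> * P\<close> \<open>C * k2 \<le> \<bar>C\<bar> * Q\<close> by (simp add: algebra_simps)
    have "\<bar>P - Q - d * m\<bar> \<le> e * m"
    proof -
      have "P - Q - d * m = - (xi s - xi t - d * (s - t))"
        using pq[of t s] by (simp add: P_def Q_def s_def algebra_simps)
      moreover have "\<bar>xi s - xi t - d * (s - t)\<bar> \<le> e * \<bar>s - t\<bar>"
        using d2[of s] s t m \<open>0 < d2\<close> by simp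
      moreover have "\<bar>s - t\<bar> = m" using s by simp
      ultimately show ?thesis by (simp only: abs_minus_cancel)
    qed
    then have "\<bar>\<bar>B\<bar> - \<bar>C\<bar>\<bar> * \<bar>P - Q - d * m\<bar> \<le> (\<bar>B\<bar> + \<bar>C\<bar>) * (e * m)"
      by (intro mult_mono) auto
    then have "(\<bar>B\<bar> - \<bar>C\<bar>) * (P - Q - d * m) \<le> (\<bar>B\<bar> + \<bar>C\<bar>) * (e * m)"
      using abs_ge_self[of "(\<bar>B\<bar> - \<bar>C\<bar>) * (P - Q - d * m)"] by (simp add: abs_mult)
    with * have "A * m \<le> ((\<bar>B\<bar> - \<bar>C\<bar>) * d + e * (1 + N + \<bar>B\<bar> + \<bar>C\<bar>)) * m"
      by (simp add: algebra_simps)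
    then show ?thesis using m by simp
  qed
  define G where "G = 1 + N + \<bar>B\<bar> + \<bar>C\<bar>"
  have "0 < G" using \<open>0 < N\<close> by (simp add: G_def)
  have "A \<le> (\<bar>B\<bar> - \<bar>C\<bar>) * d + e" if "0 < e" for e
    using approx[of "e / G"] that \<open>0 < G\<close> unfolding G_def[symmetric] by simp
  then show ?thesis by (rule field_le_epsilon)
qed

text \<open>\<open>LS_solution\<close> speaks of \<open>u\<close> only through sequences of
  viscosity solutions, so these must exist. The dynamic programming inequality is returned for the
  same function because the lower bounds are drawn from it.\<close>

lemma exists_visc_sol:
  assumes T: "0 < T" and xi: "C1_path T xi xi'" and f: "uniformly_continuous_on UNIV f"
  obtains u p q where "visc_sol T xi' f u" "sub_dpp T q p (\<lambda>x. - u x)"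
    "\<And>s t. 0 \<le> s \<Longrightarrow> s \<le> t \<Longrightarrow> t \<le> T \<Longrightarrow> p s \<le> p t \<and> q s \<le> q t"
    "\<And>s t. p t - p s - (q t - q s) = xi t - xi s"
proof -
  have xi_deriv: "\<And>t. t \<in> {0..T} \<Longrightarrow> (xi has_real_derivative xi' t) (at t within {0..T})"
    and "continuous_on {0..T} xi'"
    using xi unfolding C1_path_def by blast+
  from this(2) have "bounded (xi' ` {0..T})"
    by (intro compact_imp_bounded compact_continuous_image) simp_all
  then obtain M where M: "\<And>t. t \<in> {0..T} \<Longrightarrow> norm (xi' t) \<le> M"
    unfolding bounded_iff by blast
  have lip: "\<bar>xi t - xi s\<bar> \<le> M * (t - s)" if "0 \<le> s" "s \<le> t" "t \<le> T" for s t
  proof -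
    have "norm (xi t - xi s) \<le> M * norm (t - s)"
      by (rule field_differentiable_bound[OF convex_real_interval(5) xi_deriv M]) (use that in simp_all)
    then show ?thesis using that by simp
  qed
  text \<open>Any splitting of \<open>xi\<close> into a difference of nondecreasing Lipschitz functions would do.\<close>
  define p where "p t = (M * t + xi t) / 2" for t
  define q where "q t = (M * t - xi t) / 2" for t
  have p: "0 \<le> p t - p s \<and> p t - p s \<le> M * (t - s)"
    and q: "0 \<le> q t - q s \<and> q t - q s \<le> M * (t - s)" if "0 \<le> s" "s \<le> t" "t \<le> T" for s t
    using lip[OF that] by (auto simp: p_def q_def abs_le_iff field_simps)
  have pq: "p t - p s - (q t - q s) = xi t - xi s"
    and qp: "q t - q s - (p t - p s) = (- xi t) - (- xi s)" for s t
    by (simp_all add: p_def q_def field_simps)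
  have mono: "p s \<le> p t \<and> q s \<le> q t" if "0 \<le> s" "s \<le> t" "t \<le> T" for s t
    using p[OF that] q[OF that] by linarith
  interpret dpp_perron T p q f
    using T f mono by unfold_locales simp_all
  have "continuous_on {0..T} xi"
    using xi_deriv by (meson DERIV_continuous continuous_on_eq_continuous_within)
  then have "continuous_on {0..T} p" "continuous_on {0..T} q"
    unfolding p_def q_def by (intro continuous_intros; simp)+
  then have ucont: "uniformly_continuous_on ({0..T} \<times> UNIV) game_value"
    by (intro inherited_modulus_uniformly_continuous value_modulus value_sub_dpp value_super_dpp)
  have "visc_sol T xi' f game_value"
    unfolding visc_sol_def
  proof (intro conjI allI impI ucont; (elim conjE)?)
    fix x y show "game_value (0, x, y) = f (x, y)" by (rule value_initial)
  next
    fix t x y phi phit phix phiy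
    assume t: "0 < t" "t < T" and phi: "C1_test phi phit phix phiy"
      and max: "local_max_at (\<lambda>w. game_value w - phi w) (t, x, y)"
    have phi': "(phi has_derivative
        (\<lambda>(s, a, b). phit (t, x, y) * s + phix (t, x, y) * a + phiy (t, x, y) * b)) (at (t, x, y))"
      using phi unfolding C1_test_def by blast
    have "t \<in> {0..T}" "t \<le> T" using t by simp_all
    show "phit (t, x, y) \<le> (\<bar>phix (t, x, y)\<bar> - \<bar>phiy (t, x, y)\<bar>) * xi' t"
      by (rule sub_dpp_viscosity_inequality[where p = p and q = q and xi = xi and phi = phi and M = M,
            OF value_sub_dpp p q pq t(1) \<open>t \<le> T\<close> xi_deriv[OF \<open>t \<in> {0..T}\<close>] phi' max])
  next
    fix t x y phi phit phix phiy
    assume t: "0 < t" "t < T" and phi: "C1_test phi phit phix phiy"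
      and min: "local_min_at (\<lambda>w. game_value w - phi w) (t, x, y)"
    \<comment> \<open>The supersolution half is the subsolution half for
      \<open>- game_value\<close>, \<open>- phi\<close> and the path \<open>- xi\<close>, with
      \<open>p\<close> and \<open>q\<close> exchanged.\<close>
    have "((\<lambda>v. - phi v) has_derivative
        (\<lambda>v. - (case v of (s, a, b) \<Rightarrow> phit (t, x, y) * s + phix (t, x, y) * a + phiy (t, x, y) * b)))
        (at (t, x, y))"
      using phi unfolding C1_test_def by (intro has_derivative_minus) blast
    then have phi': "((\<lambda>v. - phi v) has_derivative
        (\<lambda>(s, a, b). - phit (t, x, y) * s + - phix (t, x, y) * a + - phiy (t, x, y) * b)) (at (t, x, y))"
      by (rule has_derivative_eq_rhs) (auto simp: fun_eq_iff)
    have xi'_neg: "((\<lambda>t. - xi t) has_real_derivative - xi' t) (at t within {0..T})"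
      using xi_deriv[of t] t by (intro DERIV_minus) auto
    have max: "local_max_at (\<lambda>w. - game_value w - - phi w) (t, x, y)"
    proof -
      obtain e where "0 < e" and e: "\<And>v. v \<in> ball (t, x, y) e \<Longrightarrow>
          game_value (t, x, y) - phi (t, x, y) \<le> game_value v - phi v"
        using min unfolding local_min_at_def by blast
      have "- game_value v - - phi v \<le> - game_value (t, x, y) - - phi (t, x, y)"
        if "v \<in> ball (t, x, y) e" for v
        using e[OF that] by simp
      with \<open>0 < e\<close> show ?thesis unfolding local_max_at_def by blast
    qed
    have "- phit (t, x, y) \<le> (\<bar>- phix (t, x, y)\<bar> - \<bar>- phiy (t, x, y)\<bar>) * - xi' t"
      by (rule sub_dpp_viscosity_inequality[where p = q and q = p and xi = "\<lambda>t. - xi t"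
            and phi = "\<lambda>v. - phi v" and M = M,
            OF value_super_dpp q p qp t(1) less_imp_le[OF t(2)] xi'_neg phi' max])
    then show "(\<bar>phix (t, x, y)\<bar> - \<bar>phiy (t, x, y)\<bar>) * xi' t \<le> phit (t, x, y)"
      by simp
  qed
  then show ?thesis
    using value_super_dpp mono pq by (rule that)
qed

section \<open>The lower bound\<close>

lemma partition_range:
  assumes "is_partition T n t" "j \<le> n"
  shows "0 \<le> t j" "t j \<le> T"
proof -
  have step: "t i \<le> t (Suc i)" if "i < n" for i using assms that by (simp add: is_partition_def)
  show "0 \<le> t j"
    using assms(2)
  proof (induction j)
    case 0 then show ?case using assms(1) by (simp add: is_partition_def)
  next
    case (Suc j) then show ?case using step[of j] by simp
  qed
  show "t j \<le> T"
    using assms(2)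
  proof (induction rule: inc_induct)
    case base then show ?case using assms(1) by (simp add: is_partition_def)
  next
    case (step i) then show ?case using \<open>i < n \<Longrightarrow> t i \<le> t (Suc i)\<close> by simp
  qed
qed

section \<open>Propagation of lower bounds along a partition\<close>

locale super_dpp_above =
  fixes T R :: real and p q xi :: "real \<Rightarrow> real" and u :: "point3 \<Rightarrow> real"
  assumes super: "sub_dpp T q p (\<lambda>x. - u x)"
    and pq_mono: "\<And>s t. 0 \<le> s \<Longrightarrow> s \<le> t \<Longrightarrow> t \<le> T \<Longrightarrow> p s \<le> p t \<and> q s \<le> q t"
    and pq: "\<And>s t. p t - p s - (q t - q s) = xi t - xi s"
    and initial_ge: "\<And>x y. \<bar>x - y\<bar> \<le> u (0, x, y)"
    and initial_ge_1: "\<And>x y. R \<le> min x y \<Longrightarrow> 1 \<le> u (0, x, y)"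
begin

text \<open>The maximizer's strategy is a single displacement, so each bound below comes down to
  naming \<open>k1\<close> and \<open>k2\<close>.\<close>

lemma lower_bound_by_control:
  assumes "0 \<le> s" "s \<le> t" "t \<le> T" "\<bar>k1\<bar> \<le> p t - p s" "\<bar>k2\<bar> \<le> q t - q s"
    and "\<And>l1 l2. \<bar>l1\<bar> \<le> q t - q s \<Longrightarrow> \<bar>l2\<bar> \<le> p t - p s \<Longrightarrow> c \<le> u (s, x + k1 + l1, y + k2 + l2)"
  shows "c \<le> u (t, x, y)"
proof (rule field_le_epsilon)
  fix e :: real assume "0 < e"
  have "(k1, k2) \<in> rect (p t - p s) (q t - q s)" using assms by (simp add: mem_rect)
  from super_dppD[OF super assms(1-3) this \<open>0 < e\<close>, of "(x, y)"]
  obtain l where l: "l \<in> rect (q t - q s) (p t - p s)"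
      "u (s, (x, y) + (k1, k2) + l) - e \<le> u (t, x, y)" by blast
  then show "c \<le> u (t, x, y) + e"
    using assms(6)[of "fst l" "snd l"] by (cases l) (simp add: mem_rect)
qed

text \<open>The maximizer widens the signed gap between \<open>x\<close> and \<open>y\<close> by
  \<open>P + Q\<close>, which is as much as the minimizer can narrow it.\<close>

lemma above_distance:
  assumes "0 \<le> t" "t \<le> T"
  shows "\<bar>x - y\<bar> \<le> u (t, x, y)"
proof -
  define P where "P = p t - p 0"
  define Q where "Q = q t - q 0"
  have PQ: "0 \<le> P" "0 \<le> Q" using pq_mono[of 0 t] assms by (auto simp: P_def Q_def)
  define \<sigma> :: real where "\<sigma> = (if y \<le> x then 1 else - 1)"
  show ?thesis
  proof (rule lower_bound_by_control[of 0 t "\<sigma> * P" "- \<sigma> * Q"])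
    fix l1 l2 assume "\<bar>l1\<bar> \<le> q t - q 0" "\<bar>l2\<bar> \<le> p t - p 0"
    then have "\<bar>x - y\<bar> \<le> \<bar>(x + \<sigma> * P + l1) - (y + - \<sigma> * Q + l2)\<bar>"
      by (auto simp: \<sigma>_def P_def Q_def)
    also have "\<dots> \<le> u (0, x + \<sigma> * P + l1, y + - \<sigma> * Q + l2)" by (rule initial_ge)
    finally show "\<bar>x - y\<bar> \<le> u (0, x + \<sigma> * P + l1, y + - \<sigma> * Q + l2)" .
  qed (use assms PQ in \<open>auto simp: \<sigma>_def P_def Q_def\<close>)
qed

text \<open>The maximizer moves \<open>x\<close> up by the increment of \<open>p\<close>, and the
  minimizer can undo at most that of \<open>q\<close>; the net gain is the increment of
  \<open>xi\<close>.\<close>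

lemma transport_x:
  assumes "0 \<le> s" "s \<le> t" "t \<le> T" "\<And>x y. r \<le> x \<Longrightarrow> c \<le> u (s, x, y)" "r - (xi t - xi s) \<le> x"
  shows "c \<le> u (t, x, y)"
  by (rule lower_bound_by_control[of s t "p t - p s" 0])
     (use assms pq_mono[of s t] pq[of t s] in \<open>auto intro!: assms(4)\<close>)

text \<open>In the second coordinate \<open>p\<close> and \<open>q\<close> change places, so the
  gain is minus the increment of \<open>xi\<close>.\<close>

lemma transport_y:
  assumes "0 \<le> s" "s \<le> t" "t \<le> T" "\<And>x y. r \<le> y \<Longrightarrow> c \<le> u (s, x, y)" "r + (xi t - xi s) \<le> y"
  shows "c \<le> u (t, x, y)"
  by (rule lower_bound_by_control[of s t 0 "q t - q s"])
     (use assms pq_mono[of s t] pq[of t s] in \<open>auto intro!: assms(4)\<close>)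

text \<open>Each step costs \<open>c\<close>, the price of passing from a quadrant to half planes;
  over \<open>n\<close> steps this produces the division by \<open>n\<close> in the final
  bound.\<close>

lemma above_on_quadrant:
  assumes t: "is_partition T n t" and "0 \<le> c" "c \<le> 1" "j \<le> n"
    "R - (\<Sum>i<j. \<bar>xi (t (Suc i)) - xi (t i)\<bar> - c) \<le> min x y"
  shows "c \<le> u (t j, x, y)"
  using assms(4,5)
proof (induction j arbitrary: x y)
  case 0
  then show ?case using initial_ge_1[of x y] assms by (simp add: is_partition_def)
next
  case (Suc j)
  define r where "r = R - (\<Sum>i<j. \<bar>xi (t (Suc i)) - xi (t i)\<bar> - c)"
  define \<delta> where "\<delta> = xi (t (Suc j)) - xi (t j)"
  have range: "0 \<le> t j" "t j \<le> t (Suc j)" "t (Suc j) \<le> T" "t j \<le> T"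
    using partition_range[OF t] t Suc.prems(1) by (auto simp: is_partition_def)
  have IH: "c \<le> u (t j, x, y)" if "r \<le> min x y" for x y
    using Suc.IH[of x y] Suc.prems(1) that by (simp add: r_def)
  have min_ge: "r + c - \<bar>\<delta>\<bar> \<le> min x y"
    using Suc.prems(2) by (simp add: r_def \<delta>_def)
  text \<open>Beyond \<open>r + c\<close> in one coordinate, either the other coordinate exceeds \<open>r\<close> or the two
    differ by at least \<open>c\<close>.\<close>
  have half_x: "c \<le> u (t j, x, y)" if "r + c \<le> x" for x y
    using IH[of x y] above_distance[of "t j" x y] range that \<open>0 \<le> c\<close> by (cases "r \<le> y") auto
  have half_y: "c \<le> u (t j, x, y)" if "r + c \<le> y" for x y
    using IH[of x y] above_distance[of "t j" x y] range that \<open>0 \<le> c\<close> by (cases "r \<le> x") auto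
  \<comment> \<open>A rising increment is exploited in \<open>x\<close>, a falling one in
    \<open>y\<close>; either way the threshold drops by \<open>\<bar>\<delta>\<bar>\<close>.\<close>
  show ?case
  proof (cases "0 \<le> \<delta>")
    case True
    then show ?thesis
      using min_ge by (intro transport_x[OF range(1-3), of "r + c"] half_x) (auto simp: \<delta>_def)
  next
    case False
    then show ?thesis
      using min_ge by (intro transport_y[OF range(1-3), of "r + c"] half_y) (auto simp: \<delta>_def)
  qed
qed

lemma partition_lower_bound:
  assumes "is_partition T n t"
  shows "min (((\<Sum>j<n. \<bar>xi (t (Suc j)) - xi (t j)\<bar>) - R) / n) 1 \<le> u (T, 0, 0)"
proof -
  define S where "S = (\<Sum>j<n. \<bar>xi (t (Suc j)) - xi (t j)\<bar>)"
  \<comment> \<open>The largest level up to 1 with \<open>n * c \<le> S - R\<close>, so that the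
    final quadrant contains the origin. A negative \<open>c\<close> is covered by nonnegativity of
    \<open>u\<close>.\<close>
  define c where "c = min ((S - R) / n) 1"
  have n: "0 < n" and tn: "t n = T" using assms by (auto simp: is_partition_def)
  have "0 \<le> u (T, 0, 0)"
    using above_distance[of T 0 0] partition_range[OF assms, of n] tn by simp
  moreover have "c \<le> u (T, 0, 0)" if "0 \<le> c"
  proof -
    have "c \<le> (S - R) / n" by (simp add: c_def)
    then have "R - (S - n * c) \<le> 0" using n by (simp add: field_simps)
    then have "c \<le> u (t n, 0, 0)"
      using that by (intro above_on_quadrant[OF assms]) (auto simp: c_def sum_subtractf S_def)
    then show ?thesis using tn by simp
  qed
  ultimately show ?thesis unfolding S_def[symmetric] c_def[symmetric] by linarith
qed

end

section \<open>From smooth to continuous paths\<close>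

lemma exists_C1_approximation:
  assumes "continuous_on {0..T} xi"
  obtains g g' where "\<And>k::nat. C1_path T (g k) (g' k)" "uniform_limit {0..T} g xi sequentially"
proof -
  obtain g where g: "\<And>k::nat. polynomial_function (g k)" "uniform_limit {0..T} g xi sequentially"
    using Stone_Weierstrass_uniform_limit[OF compact_Icc assms] by blast
  have "\<exists>g'. C1_path T (g k) g'" for k
  proof -
    obtain g' where g': "polynomial_function g'" "\<And>x. (g k has_vector_derivative g' x) (at x)"
      using has_vector_derivative_polynomial_function[OF g(1)[of k]] by blast
    then have "C1_path T (g k) g'"
      unfolding C1_path_def has_real_derivative_iff_has_vector_derivative
      by (auto intro: has_vector_derivative_at_within continuous_on_polymonial_function)
    then show ?thesis by blast
  qed
  then obtain g' where "\<And>k. C1_path T (g k) (g' k)" by metis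
  with g(2) that show ?thesis by blast
qed

text \<open>The partition is fixed before the limit is taken: its bound depends continuously on the
  path at finitely many times.\<close>

lemma LS_solution_lower_bounds:
  fixes T R :: real and xi :: "real \<Rightarrow> real" and u :: "point3 \<Rightarrow> real"
  assumes "0 < T" "continuous_on {0..T} xi" "uniformly_continuous_on UNIV f"
    and f: "\<And>x y. \<bar>x - y\<bar> \<le> f (x, y)" "\<And>x y. R \<le> min x y \<Longrightarrow> 1 \<le> f (x, y)"
    and u: "LS_solution T xi f u"
  shows "0 \<le> u (T, 0, 0)"
    and "is_partition T n t \<Longrightarrow>
      min (((\<Sum>j<n. \<bar>xi (t (Suc j)) - xi (t j)\<bar>) - R) / n) 1 \<le> u (T, 0, 0)"
proof -
  obtain g g' where g: "\<And>k::nat. C1_path T (g k) (g' k)" and lim: "uniform_limit {0..T} g xi sequentially"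
    using exists_C1_approximation[OF assms(2)] by blast
  have "\<exists>v. visc_sol T (g' k) f v \<and> (\<exists>p q. super_dpp_above T R p q (g k) v)" for k
  proof (rule exists_visc_sol[OF assms(1) g[of k] assms(3)])
    fix v p q
    assume v: "visc_sol T (g' k) f v" "sub_dpp T q p (\<lambda>x. - v x)"
      "\<And>s t. 0 \<le> s \<Longrightarrow> s \<le> t \<Longrightarrow> t \<le> T \<Longrightarrow> p s \<le> p t \<and> q s \<le> q t"
      "\<And>s t. p t - p s - (q t - q s) = g k t - g k s"
    from v(1) have "v (0, x, y) = f (x, y)" for x y by (simp add: visc_sol_def)
    then have "super_dpp_above T R p q (g k) v"
      using v(2-4) f by unfold_locales simp_all
    with v(1) show "\<exists>v. visc_sol T (g' k) f v \<and> (\<exists>p q. super_dpp_above T R p q (g k) v)" by blast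
  qed
  then obtain v where v: "\<And>k. visc_sol T (g' k) f (v k)"
    and above: "\<And>k. \<exists>p q. super_dpp_above T R p q (g k) (v k)"
    by metis
  have "locally_uniform_limit ({0..T} \<times> UNIV) v u"
    using u[unfolded LS_solution_def, THEN spec[of _ g], THEN spec[of _ g'], THEN spec[of _ v]] g lim v
    by simp
  \<comment> \<open>A single point is a compact set, so locally uniform convergence applies to
    it.\<close>
  then have v_lim: "(\<lambda>k. v k (T, 0, 0)) \<longlonglongrightarrow> u (T, 0, 0)"
    unfolding locally_uniform_limit_def using \<open>0 < T\<close>
    by (auto dest: spec[of _ "{(T, 0, 0)}"])
  have "0 \<le> v k (T, 0, 0)" for k
  proof -
    obtain p q where "super_dpp_above T R p q (g k) (v k)" using above by blast
    from super_dpp_above.above_distance[OF this, of T 0 0] show ?thesis using \<open>0 < T\<close> by simp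
  qed
  then show "0 \<le> u (T, 0, 0)"
    by (intro LIMSEQ_le_const[OF v_lim]) auto
  assume t: "is_partition T n t"
  have g_lim: "(\<lambda>k. g k (t j)) \<longlonglongrightarrow> xi (t j)" if "j \<le> n" for j
    using partition_range[OF t that] by (intro tendsto_uniform_limitI[OF lim]) auto
  have "min (((\<Sum>j<n. \<bar>g k (t (Suc j)) - g k (t j)\<bar>) - R) / n) 1 \<le> v k (T, 0, 0)" for k
  proof -
    obtain p q where "super_dpp_above T R p q (g k) (v k)" using above by blast
    then show ?thesis using t by (rule super_dpp_above.partition_lower_bound)
  qed
  moreover have "(\<lambda>k. min (((\<Sum>j<n. \<bar>g k (t (Suc j)) - g k (t j)\<bar>) - R) / n) 1)
      \<longlonglongrightarrow> min (((\<Sum>j<n. \<bar>xi (t (Suc j)) - xi (t j)\<bar>) - R) / n) 1"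
    using t by (intro tendsto_intros g_lim) (auto simp: is_partition_def)
  ultimately show "min (((\<Sum>j<n. \<bar>xi (t (Suc j)) - xi (t j)\<bar>) - R) / n) 1 \<le> u (T, 0, 0)"
    by (intro LIMSEQ_le[OF _ v_lim]) auto
qed

theorem theorem1:
  fixes T R :: real and xi :: "real \<Rightarrow> real" and Theta :: "real \<times> real \<Rightarrow> real"
    and u :: "real \<times> real \<times> real \<Rightarrow> real"
  assumes "T > 0" and "R \<ge> 0"
    and "continuous_on {0..T} xi"
    and "uniformly_continuous_on UNIV Theta"
    and "\<forall>x y. Theta (x, y) \<ge> 0"
    and "\<forall>x y. min x y \<ge> R \<longrightarrow> Theta (x, y) \<ge> 1"
    and "LS_solution T xi (\<lambda>(x, y). \<bar>x - y\<bar> + Theta (x, y)) u"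
  shows "ereal (u (T, 0, 0)) \<ge>
           min (max (SUP p \<in> {(n, t). is_partition T n t}.
                       ereal ((\<Sum>j<fst p. \<bar>xi (snd p (Suc j)) - xi (snd p j)\<bar>) / real (fst p)
                              - R / real (fst p))) 0) 1 \<and>
         (total_variation T xi > ereal R \<longrightarrow> u (T, 0, 0) > 0)"
proof -
  define f :: "real \<times> real \<Rightarrow> real" where "f = (\<lambda>(x, y). \<bar>x - y\<bar> + Theta (x, y))"
  have "uniformly_continuous_on UNIV (\<lambda>z::real \<times> real. \<bar>fst z - snd z\<bar>)"
    unfolding real_norm_def[symmetric]
    by (intro uniformly_continuous_on_norm uniformly_continuous_on_diff
          bounded_linear.uniformly_continuous_on[OF bounded_linear_fst]
          bounded_linear.uniformly_continuous_on[OF bounded_linear_snd] uniformly_continuous_on_id)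
  then have "uniformly_continuous_on UNIV f"
    unfolding f_def case_prod_beta using assms(4)
    by (intro uniformly_continuous_on_add) simp_all
  moreover have "\<bar>x - y\<bar> \<le> f (x, y)" "R \<le> min x y \<Longrightarrow> 1 \<le> f (x, y)" for x y
    using assms(5,6) by (auto simp: f_def intro: add_increasing)
  moreover have "LS_solution T xi f u" using assms(7) by (simp add: f_def)
  ultimately have nonneg: "0 \<le> u (T, 0, 0)" and bound: "\<And>n t. is_partition T n t \<Longrightarrow>
      min (((\<Sum>j<n. \<bar>xi (t (Suc j)) - xi (t j)\<bar>) - R) / n) 1 \<le> u (T, 0, 0)"
    using LS_solution_lower_bounds[of T xi f R u] assms(1,3) by blast+
  have "min (max (SUP p \<in> {(n, t). is_partition T n t}.
               ereal ((\<Sum>j<fst p. \<bar>xi (snd p (Suc j)) - xi (snd p j)\<bar>) / real (fst p)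
                      - R / real (fst p))) 0) 1 \<le> ereal (u (T, 0, 0))"
  proof (cases "1 \<le> u (T, 0, 0)")
    case True
    then show ?thesis by (simp add: min.coboundedI2)
  next
    \<comment> \<open>When the value is below 1, the cap cannot be the smaller term in any partition
      bound, so every quotient lies below the value.\<close>
    case False
    then have "(SUP p \<in> {(n, t). is_partition T n t}.
        ereal ((\<Sum>j<fst p. \<bar>xi (snd p (Suc j)) - xi (snd p j)\<bar>) / real (fst p) - R / real (fst p)))
        \<le> ereal (u (T, 0, 0))"
      using bound by (intro SUP_least) (fastforce simp: diff_divide_distrib)
    then show ?thesis using nonneg by (simp add: min.coboundedI1)
  qed
  moreover have "0 < u (T, 0, 0)" if "ereal R < total_variation T xi"
  proof -
    from that obtain n t where t: "is_partition T n t"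
      and "R < (\<Sum>j<n. \<bar>xi (t (Suc j)) - xi (t j)\<bar>)"
      unfolding total_variation_def less_SUP_iff by auto
    then have "0 < min (((\<Sum>j<n. \<bar>xi (t (Suc j)) - xi (t j)\<bar>) - R) / n) 1"
      by (auto simp: is_partition_def)
    with bound[OF t] show ?thesis by linarith
  qed
  ultimately show ?thesis by blast
qed

end
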